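(* Let $m\ge2$ and let $\{A(k)\}_{k\ge0}$ be an ergodic chain of $m\times m$ doubly stochastic matrices with a permutation component $\{P(k)\}$ and a mixing coefficient $\gamma>0$. Let $\delta\in(0,1)$, and let $\{t_q\}_{q\ge 0}$ be the accumulation times of $\{A(k)\}$ with respect to $\{P(k)\}$ and $\delta$, i.e. $t_0=0$ and, for $q\ge0$, $t_{q+1}$ is the smallest integer $t\ge t_q+1$ such that $$\min_{\emptyset\ne S(0)\subset[m]}\ \sum_{k=t_q}^{t-1}A_{S(k+1),S(k)}(k)\ \ge\ \delta,$$ where $\{S(k)\}$ is the trajectory of $S(0)$ under $\{P(k)\}$. Let $x(0)\in\mathbb{R}^m$ be arbitrary and $x(k+1)=A(k)x(k)$ for $k\ge0$. Then, for all $q\ge1$, $$V(x(t_q))\le\left(1-\frac{\gamma\delta(1-\delta)^2}{m(m-1)^2}\right)V(x(t_{q-1})).$$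
   Context: $[m]=\{1,\dots,m\}$; $S\subset[m]$ denotes a proper subset, and $\bar S=[m]\setminus S$. A matrix is stochastic if its entries are nonnegative and each row sums to $1$; it is doubly stochastic if both it and its transpose are stochastic. A vector is stochastic if its entries are nonnegative and sum to $1$; $e$ is the all-ones column vector. For $k>s\ge 0$, $A(k:s)=A(k-1)A(k-2)\cdots A(s)$ (similarly for $P(k:s)$), and $P(0:0)=I$. The chain $\{A(k)\}$ is ergodic if for every $s\ge0$ there is a stochastic vector $v(s)$ with $\lim_{k\to\infty}A(k:s)=e\,v(s)^T$. A sequence $\{P(k)\}$ of permutation matrices is a permutation component of $\{A(k)\}$ with mixing coefficient $\gamma$, where $0<\gamma\le 1$ is independent of $k$, if $A(k)=\gamma P(k)+(1-\gamma)\tilde A(k)$ for all $k\ge0$ for some sequence $\{\tilde A(k)\}$ of stochastic matrices. For a permutation matrix $P$ and $S\subset[m]$, $P(S)=\{i\in[m]\mid P_{ij}=1\text{ for some }j\in S\}$. The trajectory of $S(0)\subset[m]$ under $\{P(k)\}$ is the sequence $S(k)=P(k:0)(S(0))$, $k\ge0$. For sets $S(k)\subset[m]$, $$A_{S(k+1),S(k)}(k)=\sum_{i\in S(k+1),\,j\in\bar S(k)}A_{ij}(k)+\sum_{i\in\bar S(k+1),\,j\in S(k)}A_{ij}(k).$$ The function $V$ is $V(x)=\sum_{i=1}^m(x_i-\bar x)^2$ for $x\in\mathbb{R}^m$, where $\bar x=\frac1m e^Tx$. *)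

theory Defs
  imports "HOL-Analysis.Analysis"
begin

(* The index set [m] is a finite type 'm with m = CARD('m). *)

type_synonym 'm chain = "nat \<Rightarrow> real ^ 'm ^ 'm"

definition stochastic_matrix :: "real ^ 'm ^ 'm \<Rightarrow> bool" where
  "stochastic_matrix A \<longleftrightarrow>
     (\<forall>i j. 0 \<le> A $ i $ j) \<and> (\<forall>i. (\<Sum>j\<in>UNIV. A $ i $ j) = 1)"

definition doubly_stochastic :: "real ^ 'm ^ 'm \<Rightarrow> bool" where
  "doubly_stochastic A \<longleftrightarrow> stochastic_matrix A \<and> stochastic_matrix (transpose A)"

definition stochastic_vector :: "real ^ 'm \<Rightarrow> bool" where
  "stochastic_vector v \<longleftrightarrow> (\<forall>i. 0 \<le> v $ i) \<and> (\<Sum>i\<in>UNIV. v $ i) = 1"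

definition permutation_matrix :: "real ^ 'm ^ 'm \<Rightarrow> bool" where
  "permutation_matrix P \<longleftrightarrow>
     (\<exists>p. p permutes UNIV \<and> P = (\<chi> i j. if i = p j then 1 else 0))"

(* chain_prod A k s = A(k-1) A(k-2) ... A(s) for k > s, and the identity for k \<le> s. *)
primrec chain_prod :: "'m::finite chain \<Rightarrow> nat \<Rightarrow> nat \<Rightarrow> real ^ 'm ^ 'm" where
  "chain_prod A 0 s = mat 1"
| "chain_prod A (Suc k) s = (if s \<le> k then A k ** chain_prod A k s else mat 1)"

(* The limit matrix e v^T has every row equal to v. *)
definition ergodic_chain :: "'m::finite chain \<Rightarrow> bool" where
  "ergodic_chain A \<longleftrightarrow>
     (\<forall>s. \<exists>v. stochastic_vector v \<and>
        (\<lambda>k. chain_prod A k s) \<longlonglongrightarrow> (\<chi> i j. v $ j))"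

definition permutation_component :: "'m::finite chain \<Rightarrow> 'm chain \<Rightarrow> real \<Rightarrow> bool" where
  "permutation_component A P \<gamma> \<longleftrightarrow>
     0 < \<gamma> \<and> \<gamma> \<le> 1 \<and> (\<forall>k. permutation_matrix (P k)) \<and>
     (\<exists>B. (\<forall>k. stochastic_matrix (B k)) \<and>
          (\<forall>k. A k = \<gamma> *\<^sub>R P k + (1 - \<gamma>) *\<^sub>R B k))"

definition perm_image :: "real ^ 'm ^ 'm \<Rightarrow> 'm set \<Rightarrow> 'm set" where
  "perm_image P S = {i. \<exists>j\<in>S. P $ i $ j = 1}"

definition trajectory :: "'m::finite chain \<Rightarrow> 'm set \<Rightarrow> nat \<Rightarrow> 'm set" where
  "trajectory P S0 k = perm_image (chain_prod P k 0) S0"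

(* cross_flow M T S is M_{T,S}; it is used with T = S(k+1), S = S(k), M = A(k). *)
definition cross_flow :: "real ^ 'm ^ 'm \<Rightarrow> 'm set \<Rightarrow> 'm set \<Rightarrow> real" where
  "cross_flow M T S =
     (\<Sum>i\<in>T. \<Sum>j\<in>- S. M $ i $ j) + (\<Sum>i\<in>- T. \<Sum>j\<in>S. M $ i $ j)"

(* Trajectories always start at time 0, also when the flow is accumulated from s > 0. *)
definition accumulated_flow :: "'m::finite chain \<Rightarrow> 'm chain \<Rightarrow> nat \<Rightarrow> nat \<Rightarrow> 'm set \<Rightarrow> real" where
  "accumulated_flow A P s t S0 =
     (\<Sum>k\<in>{s..<t}. cross_flow (A k) (trajectory P S0 (Suc k)) (trajectory P S0 k))"

definition min_accumulated_flow :: "'m::finite chain \<Rightarrow> 'm chain \<Rightarrow> nat \<Rightarrow> nat \<Rightarrow> real" where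
  "min_accumulated_flow A P s t =
     Min (accumulated_flow A P s t ` {S0. S0 \<noteq> {} \<and> S0 \<noteq> UNIV})"

(* LEAST is meaningful only if a suitable t exists; for an ergodic doubly stochastic chain
   with permutation component P, CARD('m) \<ge> 2 and \<delta> < 1, this is always the case. *)
primrec accumulation_time ::
  "'m::finite chain \<Rightarrow> 'm chain \<Rightarrow> real \<Rightarrow> nat \<Rightarrow> nat" where
  "accumulation_time A P \<delta> 0 = 0"
| "accumulation_time A P \<delta> (Suc q) =
     (LEAST t. accumulation_time A P \<delta> q + 1 \<le> t \<and>
               \<delta> \<le> min_accumulated_flow A P (accumulation_time A P \<delta> q) t)"

definition mean :: "real ^ 'm \<Rightarrow> real" where
  "mean x = (\<Sum>i\<in>UNIV. x $ i) / real CARD('m)"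

definition V :: "real ^ 'm \<Rightarrow> real" where
  "V x = (\<Sum>i\<in>UNIV. (x $ i - mean x)\<^sup>2)"

end

theory Submission
  imports Defs
begin

text \<open>
The contraction has three ingredients.

\<^emph>\<open>Removing the permutations.\<close> The product of the \<open>P\<close>'s up to time \<open>k\<close> is the matrix of a
permutation \<open>\<pi> k\<close>, and the trajectory of \<open>S\<close> is \<open>\<pi> k ` S\<close>. Reading coordinate \<open>i\<close> at time \<open>k\<close> in
position \<open>\<pi> k i\<close> changes neither \<open>V\<close> nor double stochasticity. It turns trajectories into constant
sets and the permutation component into the identity, so that all diagonal entries are at least
\<open>\<gamma>\<close>. In that frame (\<open>V_contraction_self_loops\<close>) one step decreases \<open>V\<close> by at least
\<open>\<gamma>\<close> times the sum of all \<open>B i j * (x i - x j)\<^sup>2\<close> (\<open>V_decrease\<close>); only the pairs that cross a suitable cut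
\<open>S\<close> are kept.

\<^emph>\<open>Choosing the cut.\<close> Let \<open>R\<close> be the spread of the initial vector. Among its \<open>m\<close> sorted values some
consecutive gap is at least \<open>d = R / (m - 1)\<close> (\<open>exists_cut_with_gap\<close>); \<open>S\<close> lies above it. The gap
shrinks by at most the accumulated flow across the cut weighted with the differences
\<open>\<bar>x i - x j\<bar>\<close> (\<open>gap_persistence\<close>). If this loss stays below \<open>\<delta> d\<close>, every crossing pair keeps a
difference of at least \<open>(1 - \<delta>) d\<close>, and a flow of \<open>\<delta>\<close> gives a sum of squares of at least
\<open>\<delta> (1 - \<delta>)\<^sup>2 d\<^sup>2\<close>. If the loss exceeds \<open>\<delta> d\<close> before the flow reaches \<open>\<delta>\<close>, then by convexity of the square
the sum of squares is even at least \<open>\<delta> d\<^sup>2\<close> (\<open>gap_dichotomy\<close>). Together with \<open>V \<le> m R\<^sup>2\<close> this is the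
stated rate.

\<^emph>\<open>Existence of the accumulation times.\<close> The minimum in their definition is over an a priori
possibly empty set of times. Start the dynamics from the indicator of a set of size \<open>n\<close>. The mass
outside its trajectory is at most half of the accumulated flow, while ergodicity drives it to
\<open>(m - n) n / m \<ge> 1 / 2\<close>; as \<open>\<delta> < 1\<close>, the flow eventually exceeds \<open>\<delta>\<close>
(\<open>ergodic_flow_accumulates\<close>).
\<close>

section \<open>Doubly stochastic matrices\<close>

lemma doubly_stochasticD:
  assumes "doubly_stochastic M"
  shows "0 \<le> M $ i $ j" "(\<Sum>j\<in>UNIV. M $ i $ j) = 1" "(\<Sum>i\<in>UNIV. M $ i $ j) = 1"
  using assms by (auto simp: doubly_stochastic_def stochastic_matrix_def transpose_def)

lemma sum_Compl: "sum f S + sum f (- S) = sum f UNIV" for f :: "'m::finite \<Rightarrow> real"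
  by (subst sum.union_disjoint[symmetric]) (auto simp: Compl_partition)

lemma sum_matrix_vector_mult:
  fixes x :: "real ^ 'm"
  assumes "doubly_stochastic M"
  shows "(\<Sum>i\<in>UNIV. (M *v x) $ i) = (\<Sum>i\<in>UNIV. x $ i)"
proof -
  have "(\<Sum>i\<in>UNIV. (M *v x) $ i) = (\<Sum>j\<in>UNIV. \<Sum>i\<in>UNIV. M $ i $ j * x $ j)"
    by (simp add: matrix_vector_mult_def) (rule sum.swap)
  also have "\<dots> = (\<Sum>j\<in>UNIV. x $ j)"
    by (simp add: sum_distrib_right[symmetric] doubly_stochasticD[OF assms])
  finally show ?thesis .
qed

lemma V_eq_sum_squares:
  fixes x :: "real ^ 'm"
  shows "V x = (\<Sum>i\<in>UNIV. (x $ i)\<^sup>2) - real CARD('m) * (mean x)\<^sup>2"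
proof -
  have s: "(\<Sum>i\<in>UNIV. x $ i) = real CARD('m) * mean x"
    by (simp add: mean_def)
  have "V x = (\<Sum>i\<in>UNIV. (x $ i)\<^sup>2 - 2 * mean x * x $ i + (mean x)\<^sup>2)"
    by (simp add: V_def power2_diff algebra_simps)
  also have "\<dots> = (\<Sum>i\<in>UNIV. (x $ i)\<^sup>2) - 2 * mean x * (\<Sum>i\<in>UNIV. x $ i) + real CARD('m) * (mean x)\<^sup>2"
    by (simp add: sum.distrib sum_subtractf sum_distrib_left)
  finally show ?thesis
    unfolding s by (simp add: power2_eq_square)
qed

lemma V_le_card_range_sq:
  fixes x :: "real ^ 'm"
  assumes "\<And>i j. x $ i - x $ j \<le> R"
  shows "V x \<le> real CARD('m) * R\<^sup>2"
proof -
  have m: "real CARD('m) > 0" by simp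
  have "(x $ i - mean x)\<^sup>2 \<le> R\<^sup>2" for i
  proof -
    have "real CARD('m) * (x $ i - mean x) = (\<Sum>j\<in>UNIV. x $ i - x $ j)"
      by (simp add: mean_def sum_subtractf algebra_simps)
    moreover have "(\<Sum>j\<in>UNIV. x $ i - x $ j) \<le> real CARD('m) * R"
      using sum_bounded_above[of UNIV "\<lambda>j. x $ i - x $ j" R] assms by simp
    moreover have "(\<Sum>j\<in>UNIV. x $ i - x $ j) \<ge> real CARD('m) * (- R)"
    proof -
      have "- R \<le> x $ i - x $ j" for j using assms[of j i] by linarith
      then show ?thesis
        using sum_bounded_below[of UNIV "- R" "\<lambda>j. x $ i - x $ j"] by simp
    qed
    ultimately have "real CARD('m) * (x $ i - mean x) \<le> real CARD('m) * R"
      "real CARD('m) * (- R) \<le> real CARD('m) * (x $ i - mean x)" by linarith+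
    then have "x $ i - mean x \<le> R" "- R \<le> x $ i - mean x"
      using m by (simp_all only: mult_le_cancel_left_pos)
    then show ?thesis by (intro abs_le_square_iff[THEN iffD1]) linarith
  qed
  then show ?thesis
    unfolding V_def using sum_bounded_above[of UNIV "\<lambda>i. (x $ i - mean x)\<^sup>2" "R\<^sup>2"] by simp
qed

section \<open>Decrease of the variance in one step\<close>

text \<open>
The right-hand side is the variance of \<open>x\<close> under the weights \<open>w\<close>, which equals half of the double sum
of \<open>w j * w l * (x j - x l)\<^sup>2\<close>. In that sum the terms with \<open>j = i\<close> and those with \<open>l = i\<close> contribute the
left-hand side twice.
\<close>
lemma weighted_variance_ge:
  fixes w x :: "'m::finite \<Rightarrow> real"
  assumes w: "\<And>j. 0 \<le> w j" and w1: "(\<Sum>j\<in>UNIV. w j) = 1"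
  shows "w i * (\<Sum>j\<in>UNIV. w j * (x j - x i)\<^sup>2)
           \<le> (\<Sum>j\<in>UNIV. w j * (x j)\<^sup>2) - (\<Sum>j\<in>UNIV. w j * x j)\<^sup>2"
proof -
  define T where "T = (\<Sum>j\<in>UNIV. \<Sum>l\<in>UNIV. w j * w l * (x j - x l)\<^sup>2)"
  define y where "y = (\<Sum>j\<in>UNIV. w j * x j)"
  define q where "q = (\<Sum>j\<in>UNIV. w j * (x j)\<^sup>2)"
  have "(\<Sum>l\<in>UNIV. w j * w l * (x j - x l)\<^sup>2) = w j * (x j)\<^sup>2 - 2 * y * (w j * x j) + q * w j" for j
  proof -
    have "(\<Sum>l\<in>UNIV. w j * w l * (x j - x l)\<^sup>2)
        = (\<Sum>l\<in>UNIV. w j * (x j)\<^sup>2 * w l - 2 * (w j * x j) * (w l * x l) + w j * (w l * (x l)\<^sup>2))"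
      by (simp add: power2_eq_square algebra_simps)
    also have "\<dots> = w j * (x j)\<^sup>2 * (\<Sum>l\<in>UNIV. w l) - 2 * (w j * x j) * y + w j * q"
      by (simp add: sum.distrib sum_subtractf sum_distrib_left[symmetric] y_def q_def)
    finally show ?thesis by (simp add: w1)
  qed
  then have "T = (\<Sum>j\<in>UNIV. w j * (x j)\<^sup>2 - 2 * y * (w j * x j) + q * w j)"
    by (simp add: T_def)
  also have "\<dots> = q - 2 * y * y + q * (\<Sum>j\<in>UNIV. w j)"
    by (simp add: sum.distrib sum_subtractf sum_distrib_left[symmetric] y_def q_def)
  finally have T: "T = 2 * (q - y\<^sup>2)"
    by (simp add: w1 power2_eq_square)
  define E where "E = w i * (\<Sum>j\<in>UNIV. w j * (x j - x i)\<^sup>2)"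
  \<comment> \<open>Row \<open>i\<close> of the double sum is \<open>E\<close>, and so is column \<open>i\<close>, whose diagonal term vanishes.\<close>
  have "T = (\<Sum>l\<in>UNIV. w i * w l * (x i - x l)\<^sup>2)
           + (\<Sum>j\<in>UNIV - {i}. \<Sum>l\<in>UNIV. w j * w l * (x j - x l)\<^sup>2)"
    unfolding T_def by (subst sum.remove[of UNIV i]) auto
  moreover have "(\<Sum>j\<in>UNIV - {i}. w j * w i * (x j - x i)\<^sup>2)
           \<le> (\<Sum>j\<in>UNIV - {i}. \<Sum>l\<in>UNIV. w j * w l * (x j - x l)\<^sup>2)"
    by (intro sum_mono member_le_sum) (auto simp: w)
  moreover have "(\<Sum>j\<in>UNIV - {i}. w j * w i * (x j - x i)\<^sup>2) = (\<Sum>j\<in>UNIV. w j * w i * (x j - x i)\<^sup>2)"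
    by (rule sum.mono_neutral_left) auto
  moreover have "(\<Sum>j\<in>UNIV. w j * w i * (x j - x i)\<^sup>2) = E"
    by (simp add: E_def sum_distrib_left algebra_simps)
  moreover have "(\<Sum>l\<in>UNIV. w i * w l * (x i - x l)\<^sup>2) = E"
    by (simp add: E_def sum_distrib_left algebra_simps power2_commute)
  ultimately have "E \<le> q - y\<^sup>2"
    using T by (simp add: sum_distrib_left)
  then show ?thesis by (simp add: E_def q_def y_def)
qed

text \<open>
The mean is preserved, so the decrease of \<open>V\<close> is that of the sum of squares. Because the columns of
\<open>M\<close> sum to one, that decrease is the sum over all rows of the variance of \<open>x\<close> under the row, to which the
weighted variance bound applies at the diagonal entry.
\<close>
lemma V_decrease:
  fixes x :: "real ^ 'm"
  assumes M: "doubly_stochastic M" and diag: "\<And>i. \<gamma> \<le> M $ i $ i"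
  shows "\<gamma> * (\<Sum>i\<in>UNIV. \<Sum>j\<in>UNIV. M $ i $ j * (x $ j - x $ i)\<^sup>2) \<le> V x - V (M *v x)"
proof -
  have mean: "mean (M *v x) = mean x"
    by (simp add: mean_def sum_matrix_vector_mult[OF M])
  have row: "\<gamma> * (\<Sum>j\<in>UNIV. M $ i $ j * (x $ j - x $ i)\<^sup>2)
      \<le> (\<Sum>j\<in>UNIV. M $ i $ j * (x $ j)\<^sup>2) - ((M *v x) $ i)\<^sup>2" for i
  proof -
    have "0 \<le> (\<Sum>j\<in>UNIV. M $ i $ j * (x $ j - x $ i)\<^sup>2)"
      by (intro sum_nonneg) (simp add: doubly_stochasticD[OF M])
    then have "\<gamma> * (\<Sum>j\<in>UNIV. M $ i $ j * (x $ j - x $ i)\<^sup>2)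
        \<le> M $ i $ i * (\<Sum>j\<in>UNIV. M $ i $ j * (x $ j - x $ i)\<^sup>2)"
      by (rule mult_right_mono[OF diag])
    also have "\<dots> \<le> (\<Sum>j\<in>UNIV. M $ i $ j * (x $ j)\<^sup>2) - (\<Sum>j\<in>UNIV. M $ i $ j * x $ j)\<^sup>2"
      by (rule weighted_variance_ge) (simp_all add: doubly_stochasticD[OF M])
    finally show ?thesis by (simp add: matrix_vector_mult_def)
  qed
  have "\<gamma> * (\<Sum>i\<in>UNIV. \<Sum>j\<in>UNIV. M $ i $ j * (x $ j - x $ i)\<^sup>2)
      \<le> (\<Sum>i\<in>UNIV. (\<Sum>j\<in>UNIV. M $ i $ j * (x $ j)\<^sup>2) - ((M *v x) $ i)\<^sup>2)"
    unfolding sum_distrib_left[of \<gamma>] by (rule sum_mono) (use row in \<open>simp add: sum_distrib_left\<close>)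
  also have "\<dots> = (\<Sum>i\<in>UNIV. \<Sum>j\<in>UNIV. M $ i $ j * (x $ j)\<^sup>2) - (\<Sum>i\<in>UNIV. ((M *v x) $ i)\<^sup>2)"
    by (simp add: sum_subtractf)
  also have "(\<Sum>i\<in>UNIV. \<Sum>j\<in>UNIV. M $ i $ j * (x $ j)\<^sup>2) = (\<Sum>j\<in>UNIV. (x $ j)\<^sup>2)"
    by (subst sum.swap) (simp add: sum_distrib_right[symmetric] doubly_stochasticD[OF M])
  finally show ?thesis
    by (simp add: V_eq_sum_squares mean)
qed

section \<open>Flow across a cut\<close>

text \<open>
The function \<open>\<phi>\<close> selects what is accumulated along the edges of the cut: the constant one gives
the flow, the absolute value bounds how much the gap across the cut can shrink, and the square is
the part of the decrease of \<open>V\<close> that the cut accounts for.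
\<close>
definition cut_sum :: "real ^ 'm ^ 'm \<Rightarrow> 'm set \<Rightarrow> (real \<Rightarrow> real) \<Rightarrow> real ^ 'm \<Rightarrow> real" where
  "cut_sum M S \<phi> x = (\<Sum>i\<in>S. \<Sum>j\<in>- S. (M $ i $ j + M $ j $ i) * \<phi> (x $ i - x $ j))"

lemma cross_flow_eq_cut_sum: "cross_flow M S S = cut_sum M S (\<lambda>_. 1) x"
  unfolding cross_flow_def cut_sum_def
  by (subst (2) sum.swap) (simp add: sum.distrib)

lemma cut_sum_mono:
  assumes "doubly_stochastic M" and "\<And>i j. i \<in> S \<Longrightarrow> j \<notin> S \<Longrightarrow> \<phi> (x $ i - x $ j) \<le> \<psi> (x $ i - x $ j)"
  shows "cut_sum M S \<phi> x \<le> cut_sum M S \<psi> x"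
  unfolding cut_sum_def using assms
  by (intro sum_mono mult_left_mono) (auto simp: doubly_stochasticD)

lemma cut_sum_linear:
  "cut_sum M S (\<lambda>r. a * \<phi> r + b * \<psi> r) x = a * cut_sum M S \<phi> x + b * cut_sum M S \<psi> x"
  by (simp add: cut_sum_def sum.distrib[symmetric] sum_distrib_left algebra_simps)

lemma V_decrease_cut:
  fixes x :: "real ^ 'm"
  assumes M: "doubly_stochastic M" and diag: "\<And>i. \<gamma> \<le> M $ i $ i" and "0 \<le> \<gamma>"
  shows "\<gamma> * cut_sum M S (\<lambda>r. r\<^sup>2) x \<le> V x - V (M *v x)"
proof -
  let ?g = "\<lambda>i j. M $ i $ j * (x $ j - x $ i)\<^sup>2"
  have g: "0 \<le> ?g i j" for i j by (simp add: doubly_stochasticD[OF M])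
  have "cut_sum M S (\<lambda>r. r\<^sup>2) x = (\<Sum>i\<in>S. \<Sum>j\<in>- S. ?g i j) + (\<Sum>i\<in>S. \<Sum>j\<in>- S. ?g j i)"
    unfolding cut_sum_def by (simp add: sum.distrib[symmetric] algebra_simps power2_commute)
  also have "(\<Sum>i\<in>S. \<Sum>j\<in>- S. ?g j i) = (\<Sum>i\<in>- S. \<Sum>j\<in>S. ?g i j)"
    by (rule sum.swap)
  also have "(\<Sum>i\<in>S. \<Sum>j\<in>- S. ?g i j) + (\<Sum>i\<in>- S. \<Sum>j\<in>S. ?g i j)
      \<le> (\<Sum>i\<in>S. \<Sum>j\<in>UNIV. ?g i j) + (\<Sum>i\<in>- S. \<Sum>j\<in>UNIV. ?g i j)"
    by (intro add_mono sum_mono sum_mono2) (auto simp: g)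
  also have "\<dots> = (\<Sum>i\<in>UNIV. \<Sum>j\<in>UNIV. ?g i j)"
    by (rule sum_Compl)
  finally have "\<gamma> * cut_sum M S (\<lambda>r. r\<^sup>2) x \<le> \<gamma> * (\<Sum>i\<in>UNIV. \<Sum>j\<in>UNIV. ?g i j)"
    using \<open>0 \<le> \<gamma>\<close> by (rule mult_left_mono)
  also have "\<dots> \<le> V x - V (M *v x)" by (rule V_decrease[OF M diag])
  finally show ?thesis .
qed

text \<open>
An average over row \<open>i\<close> falls below \<open>u\<close> only through entries outside \<open>S\<close>, and for such an entry
\<open>u - x j\<close> is at most \<open>x i - x j\<close>. Measuring the loss by \<open>\<bar>x i - x j\<bar>\<close> instead of by the whole spread of
\<open>x\<close> is what makes it comparable with the decrease of \<open>V\<close>.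
\<close>
lemma lower_bound_step:
  fixes x :: "real ^ 'm"
  assumes M: "doubly_stochastic M" and u: "\<And>i. i \<in> S \<Longrightarrow> u \<le> x $ i" and "i \<in> S"
  shows "u - (\<Sum>i\<in>S. \<Sum>j\<in>- S. M $ i $ j * \<bar>x $ i - x $ j\<bar>) \<le> (M *v x) $ i"
proof -
  note nn = doubly_stochasticD(1)[OF M]
  have "u - (M *v x) $ i = (\<Sum>j\<in>UNIV. M $ i $ j * (u - x $ j))"
    using doubly_stochasticD(2)[OF M, of i]
    by (simp add: matrix_vector_mult_def right_diff_distrib sum_subtractf sum_distrib_right[symmetric])
  also have "\<dots> = (\<Sum>j\<in>S. M $ i $ j * (u - x $ j)) + (\<Sum>j\<in>- S. M $ i $ j * (u - x $ j))"
    by (rule sum_Compl[symmetric])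
  also have "(\<Sum>j\<in>S. M $ i $ j * (u - x $ j)) \<le> 0"
    by (intro sum_nonpos mult_nonneg_nonpos) (use u nn in auto)
  also have "(\<Sum>j\<in>- S. M $ i $ j * (u - x $ j)) \<le> (\<Sum>j\<in>- S. M $ i $ j * \<bar>x $ i - x $ j\<bar>)"
    using u[OF \<open>i \<in> S\<close>] by (intro sum_mono mult_left_mono nn) linarith
  also have "\<dots> \<le> (\<Sum>i\<in>S. \<Sum>j\<in>- S. M $ i $ j * \<bar>x $ i - x $ j\<bar>)"
    using \<open>i \<in> S\<close> by (intro member_le_sum sum_nonneg mult_nonneg_nonneg nn) auto
  finally show ?thesis by linarith
qed

text \<open>
The entries of \<open>S\<close> can only be pulled down, and the others pushed up, by edges of the cut. The upper
bound outside \<open>S\<close> is the lower bound for \<open>- x\<close> and the complement of \<open>S\<close>.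
\<close>
lemma gap_persistence:
  fixes x :: "nat \<Rightarrow> real ^ 'm"
  assumes B: "\<And>k. doubly_stochastic (B k)" and x: "\<And>k. x (Suc k) = B k *v x k"
    and u: "\<And>i. i \<in> S \<Longrightarrow> u \<le> x 0 $ i" and l: "\<And>i. i \<notin> S \<Longrightarrow> x 0 $ i \<le> l"
    and "i \<in> S" "j \<notin> S"
  shows "u - l - (\<Sum>k<n. cut_sum (B k) S abs (x k)) \<le> x n $ i - x n $ j"
proof -
  define a where "a k = (\<Sum>i\<in>S. \<Sum>j\<in>- S. B k $ i $ j * \<bar>x k $ i - x k $ j\<bar>)" for k
  define b where "b k = (\<Sum>i\<in>- S. \<Sum>j\<in>S. B k $ i $ j * \<bar>x k $ i - x k $ j\<bar>)" for k
  have cut: "cut_sum (B k) S abs (x k) = a k + b k" for k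
  proof -
    have "b k = (\<Sum>i\<in>S. \<Sum>j\<in>- S. B k $ j $ i * \<bar>x k $ j - x k $ i\<bar>)"
      unfolding b_def by (rule sum.swap)
    then show ?thesis
      unfolding cut_sum_def a_def
      by (simp add: sum.distrib[symmetric] algebra_simps abs_minus_commute)
  qed
  have low: "\<forall>i\<in>S. u - (\<Sum>k<n. a k) \<le> x n $ i"
  proof (induction n)
    case (Suc n)
    then show ?case
      using lower_bound_step[OF B, of S "u - (\<Sum>k<n. a k)" "x n" _ n]
      by (auto simp: x a_def diff_diff_eq)
  qed (use u in auto)
  have high: "\<forall>i\<in>- S. x n $ i \<le> l + (\<Sum>k<n. b k)"
  proof (induction n)
    case (Suc n)
    show ?case
    proof
      fix i assume "i \<in> - S"
      moreover have "\<And>i. i \<in> - S \<Longrightarrow> - (l + (\<Sum>k<n. b k)) \<le> (- x n) $ i"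
        using Suc by (auto simp: algebra_simps)
      ultimately have "- (l + (\<Sum>k<n. b k)) - (\<Sum>i\<in>- S. \<Sum>j\<in>- (- S). B n $ i $ j * \<bar>(- x n) $ i - (- x n) $ j\<bar>)
          \<le> (B n *v (- x n)) $ i"
        by (intro lower_bound_step[OF B])
      moreover have "B n *v (- x n) = - x (Suc n)"
        unfolding x by (metis scaleR_minus1_left matrix_vector_mult_scaleR)
      ultimately show "x (Suc n) $ i \<le> l + (\<Sum>k<Suc n. b k)"
        by (simp add: b_def abs_minus_commute)
    qed
  qed (use l in auto)
  show ?thesis
    using low[rule_format, OF \<open>i \<in> S\<close>] high[rule_format, of j] \<open>j \<notin> S\<close>
    by (simp add: cut sum.distrib)
qed

section \<open>The accumulated decrease\<close>

text \<open>
Here \<open>f\<close>, \<open>L\<close> and \<open>D\<close> are the flow, the loss of gap and the sum of squares at each time. As long as the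
accumulated loss is at most \<open>\<delta> * d\<close>, the gap is at least \<open>(1 - \<delta>) * d\<close>. At the first time this fails, either
the flow has already reached \<open>\<delta>\<close>, or a loss above \<open>\<delta> * d\<close> was caused by a flow below \<open>\<delta>\<close>, and the tangent
bound \<open>r\<^sup>2 \<ge> 2 * d * \<bar>r\<bar> - d\<^sup>2\<close>, summed over the cut, gives at least \<open>2 * d * (\<delta> * d) - d\<^sup>2 * \<delta> = \<delta> * d\<^sup>2\<close>.
\<close>
lemma gap_dichotomy:
  fixes f L D :: "nat \<Rightarrow> real"
  assumes d: "0 \<le> d" and \<delta>: "0 < \<delta>" "\<delta> < 1"
    and D: "\<And>k. 0 \<le> D k"
    and tangent: "\<And>k. 2 * d * L k - d\<^sup>2 * f k \<le> D k"
    and open_gap: "\<And>k. (\<Sum>j<k. L j) \<le> \<delta> * d \<Longrightarrow> ((1 - \<delta>) * d)\<^sup>2 * f k \<le> D k"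
    and flow: "\<delta> \<le> (\<Sum>k<n. f k)"
  shows "\<delta> * ((1 - \<delta>) * d)\<^sup>2 \<le> (\<Sum>k<n. D k)"
proof -
  have enough: "\<delta> * ((1 - \<delta>) * d)\<^sup>2 \<le> (\<Sum>k<N. D k)"
    if "\<And>k. k < N \<Longrightarrow> (\<Sum>j<k. L j) \<le> \<delta> * d" "\<delta> \<le> (\<Sum>k<N. f k)" for N
  proof -
    have "\<delta> * ((1 - \<delta>) * d)\<^sup>2 \<le> (\<Sum>k<N. f k) * ((1 - \<delta>) * d)\<^sup>2"
      by (rule mult_right_mono[OF that(2)]) simp
    also have "\<dots> = (\<Sum>k<N. ((1 - \<delta>) * d)\<^sup>2 * f k)"
      by (simp add: sum_distrib_right mult.commute)
    also have "\<dots> \<le> (\<Sum>k<N. D k)"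
      by (rule sum_mono) (use that open_gap in auto)
    finally show ?thesis .
  qed
  show ?thesis
  proof (cases "\<forall>k<n. (\<Sum>j<k. L j) \<le> \<delta> * d")
    case True
    then show ?thesis using enough flow by auto
  next
    case False
    define N where "N = (LEAST k. \<delta> * d < (\<Sum>j<k. L j))"
    obtain k where k: "k < n" "\<delta> * d < (\<Sum>j<k. L j)" using False by force
    have N: "\<delta> * d < (\<Sum>j<N. L j)" unfolding N_def by (rule LeastI, rule k)
    have "N \<le> n" unfolding N_def using k by (meson Least_le less_imp_le order_trans)
    have before: "(\<Sum>j<k. L j) \<le> \<delta> * d" if "k < N" for k
      using not_less_Least[of k "\<lambda>k. \<delta> * d < (\<Sum>j<k. L j)"] that unfolding N_def by force
    have "\<delta> * ((1 - \<delta>) * d)\<^sup>2 \<le> (\<Sum>k<N. D k)"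
    proof (cases "\<delta> \<le> (\<Sum>k<N. f k)")
      case True
      then show ?thesis using enough before by auto
    next
      case False
      have "\<delta> * ((1 - \<delta>) * d)\<^sup>2 \<le> \<delta> * d\<^sup>2"
        using d \<delta> by (intro mult_left_mono power_mono mult_left_le_one_le) auto
      also have "\<dots> = 2 * d * (\<delta> * d) - d\<^sup>2 * \<delta>"
        by (simp add: power2_eq_square)
      also have "\<dots> \<le> 2 * d * (\<Sum>k<N. L k) - d\<^sup>2 * (\<Sum>k<N. f k)"
        using False N d by (intro diff_mono mult_left_mono) auto
      also have "\<dots> = (\<Sum>k<N. 2 * d * L k - d\<^sup>2 * f k)"
        by (simp add: sum_subtractf sum_distrib_left)
      also have "\<dots> \<le> (\<Sum>k<N. D k)"
        by (rule sum_mono) (rule tangent)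
      finally show ?thesis .
    qed
    also have "\<dots> \<le> (\<Sum>k<n. D k)"
      using \<open>N \<le> n\<close> D by (intro sum_mono2) auto
    finally show ?thesis .
  qed
qed

text \<open>
The \<open>m - 1\<close> gaps between consecutive sorted values add up to the spread \<open>R\<close>, so one of them is at
least their average; \<open>S\<close> consists of the indices above it. Sorting the indices and not the values
keeps ties, so a constant \<open>x\<close> needs no separate treatment.
\<close>
lemma exists_cut_with_gap:
  fixes x :: "'m::finite \<Rightarrow> real"
  assumes m: "2 \<le> CARD('m)"
  obtains S u l R where "S \<noteq> {}" "S \<noteq> UNIV" "\<And>i. i \<in> S \<Longrightarrow> u \<le> x i" "\<And>i. i \<notin> S \<Longrightarrow> x i \<le> l"
    "\<And>i j. x i - x j \<le> R" "0 \<le> R" "R / (real CARD('m) - 1) \<le> u - l"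
proof -
  obtain xs0 :: "'m list" where xs0: "set xs0 = UNIV" "distinct xs0"
    using finite_distinct_list[of "UNIV :: 'm set"] by auto
  define xs where "xs = sort_key x xs0"
  have set: "set xs = UNIV" and dist: "distinct xs" using xs0 by (auto simp: xs_def)
  have len: "length xs = CARD('m)" using distinct_card[OF dist] set by simp
  have srt: "x (xs ! i) \<le> x (xs ! j)" if "i \<le> j" "j < CARD('m)" for i j
  proof -
    have "sorted (map x xs)" by (simp add: xs_def)
    from sorted_nth_mono[OF this \<open>i \<le> j\<close>] show ?thesis using that len by simp
  qed
  have nth: "\<exists>k<CARD('m). i = xs ! k" for i
    using set len by (metis UNIV_I in_set_conv_nth)
  define n where "n = CARD('m) - 1"
  define R where "R = x (xs ! n) - x (xs ! 0)"
  have n: "0 < n" "Suc n = CARD('m)" "real n = real CARD('m) - 1" using m by (auto simp: n_def)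
  have "\<exists>k<n. R / real n \<le> x (xs ! Suc k) - x (xs ! k)"
  proof (rule ccontr)
    assume "\<not> ?thesis"
    then have "(\<Sum>k<n. x (xs ! Suc k) - x (xs ! k)) < (\<Sum>k<n. R / real n)"
      using n by (intro sum_strict_mono) auto
    then show False using n by (simp add: sum_lessThan_telescope[of "\<lambda>k. x (xs ! k)"] R_def)
  qed
  then obtain k where k: "k < n" "R / real n \<le> x (xs ! Suc k) - x (xs ! k)" by blast
  define S where "S = {i. \<exists>j. k < j \<and> j < CARD('m) \<and> i = xs ! j}"
  show ?thesis
  proof (rule that[of S "x (xs ! Suc k)" "x (xs ! k)" R])
    have "xs ! Suc k \<in> S" unfolding S_def using k n by (auto intro!: exI[of _ "Suc k"])
    then show "S \<noteq> {}" by blast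
    have "xs ! k \<notin> S"
      using dist len k n by (auto simp: S_def nth_eq_iff_index_eq)
    then show "S \<noteq> UNIV" by auto
    show "x (xs ! Suc k) \<le> x i" if "i \<in> S" for i
      using that srt by (auto simp: S_def)
    show "x i \<le> x (xs ! k)" if "i \<notin> S" for i
    proof -
      obtain j where j: "j < CARD('m)" "i = xs ! j" using nth by blast
      then have "j \<le> k" using that by (auto simp: S_def not_le)
      then show ?thesis using j k n srt by auto
    qed
    show "x i - x j \<le> R" for i j
    proof -
      obtain a b where "a < CARD('m)" "i = xs ! a" "b < CARD('m)" "j = xs ! b" using nth by meson
      then have "x i \<le> x (xs ! n)" "x (xs ! 0) \<le> x j" using srt n by auto
      then show ?thesis by (simp add: R_def)
    qed
    then show "0 \<le> R" by (metis diff_self)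
    show "R / (real CARD('m) - 1) \<le> x (xs ! Suc k) - x (xs ! k)" using k n by simp
  qed
qed

lemma V_contraction_self_loops:
  fixes x :: "nat \<Rightarrow> real ^ 'm"
  assumes m: "2 \<le> CARD('m)"
    and B: "\<And>k. doubly_stochastic (B k)" and diag: "\<And>k i. \<gamma> \<le> B k $ i $ i" and \<gamma>: "0 < \<gamma>"
    and x: "\<And>k. x (Suc k) = B k *v x k"
    and \<delta>: "0 < \<delta>" "\<delta> < 1"
    and flow: "\<And>S. S \<noteq> {} \<Longrightarrow> S \<noteq> UNIV \<Longrightarrow> \<delta> \<le> (\<Sum>k<n. cross_flow (B k) S S)"
  shows "V (x n) \<le> (1 - \<gamma> * \<delta> * (1 - \<delta>)\<^sup>2 / (real CARD('m) * (real CARD('m) - 1)\<^sup>2)) * V (x 0)"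
proof -
  obtain S u l R where S: "S \<noteq> {}" "S \<noteq> UNIV"
    and u: "\<And>i. i \<in> S \<Longrightarrow> u \<le> x 0 $ i" and l: "\<And>i. i \<notin> S \<Longrightarrow> x 0 $ i \<le> l"
    and R: "\<And>i j. x 0 $ i - x 0 $ j \<le> R" "0 \<le> R" and gap: "R / (real CARD('m) - 1) \<le> u - l"
    using exists_cut_with_gap[OF m, of "\<lambda>i. x 0 $ i"] by metis
  define d where "d = R / (real CARD('m) - 1)"
  define D where "D k = cut_sum (B k) S (\<lambda>r. r\<^sup>2) (x k)" for k
  define L where "L k = cut_sum (B k) S abs (x k)" for k
  define f where "f k = cut_sum (B k) S (\<lambda>_. 1) (x k)" for k
  have d: "0 \<le> d" using R m by (simp add: d_def)
  have "\<delta> * ((1 - \<delta>) * d)\<^sup>2 \<le> (\<Sum>k<n. D k)"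
  proof (rule gap_dichotomy[OF d \<delta>, where L = L and f = f])
    show "0 \<le> D k" for k
      unfolding D_def cut_sum_def by (intro sum_nonneg) (simp add: doubly_stochasticD[OF B])
    show "2 * d * L k - d\<^sup>2 * f k \<le> D k" for k
    proof -
      have "2 * d * L k - d\<^sup>2 * f k = cut_sum (B k) S (\<lambda>r. 2 * d * \<bar>r\<bar> + (- d\<^sup>2) * 1) (x k)"
        by (simp only: L_def f_def cut_sum_linear)
      also have "\<dots> \<le> D k"
        unfolding D_def
      proof (rule cut_sum_mono[OF B])
        fix i j
        have "0 \<le> (\<bar>x k $ i - x k $ j\<bar> - d)\<^sup>2" by simp
        then show "2 * d * \<bar>x k $ i - x k $ j\<bar> + (- d\<^sup>2) * 1 \<le> (x k $ i - x k $ j)\<^sup>2"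
          by (simp add: power2_diff algebra_simps)
      qed
      finally show ?thesis .
    qed
    show "((1 - \<delta>) * d)\<^sup>2 * f k \<le> D k" if "(\<Sum>j<k. L j) \<le> \<delta> * d" for k
    proof -
      have "((1 - \<delta>) * d)\<^sup>2 * f k = cut_sum (B k) S (\<lambda>_. ((1 - \<delta>) * d)\<^sup>2) (x k)"
        by (simp add: f_def cut_sum_def sum_distrib_left mult.commute)
      also have "\<dots> \<le> D k"
        unfolding D_def
      proof (rule cut_sum_mono[OF B])
        fix i j assume "i \<in> S" "j \<notin> S"
        then have "u - l - (\<Sum>j<k. L j) \<le> x k $ i - x k $ j"
          unfolding L_def by (intro gap_persistence[where S = S and B = B] B x u l)
        then have "(1 - \<delta>) * d \<le> x k $ i - x k $ j"
          using that gap unfolding d_def[symmetric] by (simp add: left_diff_distrib)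
        then show "((1 - \<delta>) * d)\<^sup>2 \<le> (x k $ i - x k $ j)\<^sup>2"
          using d \<delta> by (intro power_mono) auto
      qed
      finally show ?thesis .
    qed
    show "\<delta> \<le> (\<Sum>k<n. f k)"
      using flow[OF S] by (simp add: f_def cross_flow_eq_cut_sum[symmetric])
  qed
  then have "\<gamma> * (\<delta> * ((1 - \<delta>) * d)\<^sup>2) \<le> \<gamma> * (\<Sum>k<n. D k)"
    using \<gamma> by simp
  also have "\<dots> = (\<Sum>k<n. \<gamma> * D k)" by (rule sum_distrib_left)
  also have "\<dots> \<le> (\<Sum>k<n. V (x k) - V (x (Suc k)))"
    unfolding D_def x using \<gamma> by (intro sum_mono V_decrease_cut B diag) auto
  also have "\<dots> = V (x 0) - V (x n)" by (rule sum_lessThan_telescope')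
  finally have "\<gamma> * \<delta> * (1 - \<delta>)\<^sup>2 / (real CARD('m) - 1)\<^sup>2 * R\<^sup>2 \<le> V (x 0) - V (x n)"
    by (simp add: d_def power_mult_distrib power_divide mult_ac)
  moreover have "V (x 0) / real CARD('m) \<le> R\<^sup>2"
    using V_le_card_range_sq[OF R(1)] by (simp add: divide_le_eq mult.commute)
  then have "\<gamma> * \<delta> * (1 - \<delta>)\<^sup>2 / (real CARD('m) - 1)\<^sup>2 * (V (x 0) / real CARD('m))
      \<le> \<gamma> * \<delta> * (1 - \<delta>)\<^sup>2 / (real CARD('m) - 1)\<^sup>2 * R\<^sup>2"
    using \<gamma> \<delta> by (intro mult_left_mono) auto
  ultimately show ?thesis
    by (simp add: algebra_simps)
qed

section \<open>Following the permutation component\<close>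

text \<open>
The third conclusion says that in the coordinates given by \<open>\<pi>\<close> the permutation component is
the identity.
\<close>
lemma chain_prod_permutation:
  fixes P :: "'m::finite chain"
  assumes "\<And>k. permutation_matrix (P k)"
  obtains \<pi> :: "nat \<Rightarrow> 'm \<Rightarrow> 'm" where "\<And>k. bij (\<pi> k)"
    "\<And>k S. trajectory P S k = \<pi> k ` S" "\<And>k i. P k $ \<pi> (Suc k) i $ \<pi> k i = 1"
proof -
  have "\<forall>k. \<exists>p. bij p \<and> P k = (\<chi> i j. if i = p j then 1 else 0)"
    using assms unfolding permutation_matrix_def by (meson permutes_bij)
  then obtain p where p: "\<And>k. bij (p k)" "\<And>k. P k = (\<chi> i j. if i = p k j then 1 else 0)"
    by metis
  define \<pi> where "\<pi> k = rec_nat id (\<lambda>k f. p k \<circ> f) k" for k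
  have \<pi>: "\<pi> 0 = id" "\<pi> (Suc k) = p k \<circ> \<pi> k" for k by (simp_all add: \<pi>_def)
  have prod: "chain_prod P k 0 = (\<chi> i j. if i = \<pi> k j then 1 else 0)" for k
  proof (induction k)
    case 0
    show ?case by (simp add: \<pi> mat_def vec_eq_iff)
  next
    case (Suc k)
    have "(\<Sum>l\<in>UNIV. (if i = p k l then 1 else 0) * (if l = \<pi> k j then 1 else 0 :: real))
        = (if i = p k (\<pi> k j) then 1 else 0)" for i j
      by (subst sum.remove[of UNIV "\<pi> k j"]) (auto intro: sum.neutral)
    then show ?case
      by (simp add: Suc \<pi> matrix_matrix_mult_def p(2)[of k] vec_eq_iff)
  qed
  show ?thesis
  proof (rule that[of \<pi>])
    show "bij (\<pi> k)" for k by (induction k) (auto simp: \<pi> intro: bij_comp p simp del: id_apply comp_apply)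
    show "trajectory P S k = \<pi> k ` S" for k S
      by (auto simp: trajectory_def perm_image_def prod split: if_splits)
    show "P k $ \<pi> (Suc k) i $ \<pi> k i = 1" for k i by (simp add: \<pi> p(2))
  qed
qed

lemma cross_flow_image:
  assumes "bij p" "bij q"
  shows "cross_flow M (p ` S) (q ` S) = cross_flow (\<chi> i j. M $ p i $ q j) S S"
proof -
  have inj: "inj_on p U" "inj_on q U" for U using assms by (auto simp: bij_def inj_on_def)
  show ?thesis
    unfolding cross_flow_def bij_image_Compl_eq[OF assms(1), symmetric]
      bij_image_Compl_eq[OF assms(2), symmetric]
    by (simp add: sum.reindex[OF inj(1)] sum.reindex[OF inj(2)])
qed

lemma doubly_stochastic_permute:
  assumes M: "doubly_stochastic M" and "bij p" "bij q"
  shows "doubly_stochastic (\<chi> i j. M $ p i $ q j)"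
proof -
  have "(\<Sum>j\<in>UNIV. M $ p i $ q j) = 1" for i
    using sum.reindex_bij_betw[OF \<open>bij q\<close>, of "\<lambda>j. M $ p i $ j"] doubly_stochasticD(2)[OF M] by simp
  moreover have "(\<Sum>i\<in>UNIV. M $ p i $ q j) = 1" for j
    using sum.reindex_bij_betw[OF \<open>bij p\<close>, of "\<lambda>i. M $ i $ q j"] doubly_stochasticD(3)[OF M] by simp
  ultimately show ?thesis
    by (simp add: doubly_stochastic_def stochastic_matrix_def transpose_def doubly_stochasticD(1)[OF M])
qed

lemma V_permute:
  fixes x :: "real ^ 'm" and p :: "'m \<Rightarrow> 'm"
  assumes "bij p"
  shows "V (\<chi> i. x $ p i) = V x"
proof -
  have "mean (\<chi> i. x $ p i) = mean x"
    unfolding mean_def using sum.reindex_bij_betw[OF assms, of "\<lambda>i. x $ i"] by simp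
  then show ?thesis
    unfolding V_def using sum.reindex_bij_betw[OF assms, of "\<lambda>i. (x $ i - mean x)\<^sup>2"] by simp
qed

lemma V_contraction:
  fixes x :: "nat \<Rightarrow> real ^ 'm"
  assumes m: "2 \<le> CARD('m)"
    and A: "\<And>k. doubly_stochastic (A k)" and P: "permutation_component A P \<gamma>"
    and \<delta>: "0 < \<delta>" "\<delta> < 1" and x: "\<And>k. x (Suc k) = A k *v x k" and "s \<le> t"
    and flow: "\<And>S. S \<noteq> {} \<Longrightarrow> S \<noteq> UNIV \<Longrightarrow> \<delta> \<le> accumulated_flow A P s t S"
  shows "V (x t) \<le> (1 - \<gamma> * \<delta> * (1 - \<delta>)\<^sup>2 / (real CARD('m) * (real CARD('m) - 1)\<^sup>2)) * V (x s)"
proof -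
  obtain B' where \<gamma>: "0 < \<gamma>" "\<gamma> \<le> 1" and perm: "\<And>k. permutation_matrix (P k)"
    and B': "\<And>k. stochastic_matrix (B' k)" and A_eq: "\<And>k. A k = \<gamma> *\<^sub>R P k + (1 - \<gamma>) *\<^sub>R B' k"
    using P unfolding permutation_component_def by (elim conjE exE) (rule that, blast+)
  obtain \<pi> :: "nat \<Rightarrow> 'm \<Rightarrow> 'm" where \<pi>: "\<And>k. bij (\<pi> k)"
    and traj: "\<And>k S. trajectory P S k = \<pi> k ` S" and P1: "\<And>k i. P k $ \<pi> (Suc k) i $ \<pi> k i = 1"
    by (rule chain_prod_permutation[OF perm]) (rule that)
  define B :: "nat \<Rightarrow> real ^ 'm ^ 'm"
    where "B k = (\<chi> i j. A (s + k) $ \<pi> (Suc (s + k)) i $ \<pi> (s + k) j)" for k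
  define y :: "nat \<Rightarrow> real ^ 'm" where "y k = (\<chi> i. x (s + k) $ \<pi> (s + k) i)" for k
  have "V (y (t - s)) \<le> (1 - \<gamma> * \<delta> * (1 - \<delta>)\<^sup>2 / (real CARD('m) * (real CARD('m) - 1)\<^sup>2)) * V (y 0)"
  proof (rule V_contraction_self_loops[OF m, where B = B])
    show "doubly_stochastic (B k)" for k
      unfolding B_def by (intro doubly_stochastic_permute A \<pi>)
    show "\<gamma> \<le> B k $ i $ i" for k i
      using \<gamma> B' by (simp add: B_def A_eq P1 stochastic_matrix_def)
    show "y (Suc k) = B k *v y k" for k
      using sum.reindex_bij_betw[OF \<pi>, of "\<lambda>j. A (s + k) $ _ $ j * x (s + k) $ j" "s + k"]
      by (simp add: vec_eq_iff y_def B_def x matrix_vector_mult_def)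
    show "\<delta> \<le> (\<Sum>k<t - s. cross_flow (B k) S S)" if "S \<noteq> {}" "S \<noteq> UNIV" for S
    proof -
      have "accumulated_flow A P s t S
          = (\<Sum>k<t - s. cross_flow (A (s + k)) (\<pi> (Suc (s + k)) ` S) (\<pi> (s + k) ` S))"
        by (simp add: accumulated_flow_def traj sum.atLeastLessThan_shift_0[of _ s] atLeast0LessThan)
      also have "\<dots> = (\<Sum>k<t - s. cross_flow (B k) S S)"
        by (simp add: cross_flow_image[OF \<pi> \<pi>] B_def)
      finally show ?thesis using flow[OF that] by simp
    qed
  qed (use \<gamma> \<delta> in auto)
  then show ?thesis
    using \<open>s \<le> t\<close> V_permute[OF \<pi>] by (simp add: y_def)
qed

section \<open>Ergodicity forces flow, so accumulation times exist\<close>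

lemma cross_flow_nonneg: "doubly_stochastic M \<Longrightarrow> 0 \<le> cross_flow M T S"
  unfolding cross_flow_def by (intro add_nonneg_nonneg sum_nonneg) (auto simp: doubly_stochasticD)

text \<open>
Rows and columns both have total weight one, so the weight entering and the weight leaving differ
from \<open>card T\<close> and \<open>card S\<close> by the same internal weight. This factor of two matters: the limiting mass outside
is only guaranteed to be \<open>1 / 2\<close>, in the extreme case \<open>m = 2\<close>.
\<close>
lemma cross_flow_eq_twice_outflow:
  fixes M :: "real ^ 'm ^ 'm"
  assumes M: "doubly_stochastic M" and "card T = card S"
  shows "cross_flow M T S = 2 * (\<Sum>i\<in>- T. \<Sum>j\<in>S. M $ i $ j)"
proof -
  let ?I = "\<Sum>i\<in>T. \<Sum>j\<in>S. M $ i $ j"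
  have "?I + (\<Sum>i\<in>T. \<Sum>j\<in>- S. M $ i $ j) = (\<Sum>i\<in>T. \<Sum>j\<in>UNIV. M $ i $ j)"
    by (simp add: sum.distrib[symmetric] sum_Compl)
  also have "\<dots> = real (card T)" by (simp add: doubly_stochasticD[OF M])
  finally have rows: "?I + (\<Sum>i\<in>T. \<Sum>j\<in>- S. M $ i $ j) = real (card T)" .
  have "?I + (\<Sum>i\<in>- T. \<Sum>j\<in>S. M $ i $ j) = (\<Sum>i\<in>UNIV. \<Sum>j\<in>S. M $ i $ j)"
    by (rule sum_Compl)
  also have "\<dots> = (\<Sum>j\<in>S. \<Sum>i\<in>UNIV. M $ i $ j)" by (rule sum.swap)
  also have "\<dots> = real (card S)" by (simp add: doubly_stochasticD[OF M])
  finally have "?I + (\<Sum>i\<in>- T. \<Sum>j\<in>S. M $ i $ j) = real (card S)" .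
  with rows show ?thesis using assms(2) unfolding cross_flow_def by linarith
qed

lemma outside_mass_step:
  fixes z :: "real ^ 'm"
  assumes M: "doubly_stochastic M" and z: "\<And>i. 0 \<le> z $ i" "\<And>i. z $ i \<le> 1"
  shows "(\<Sum>i\<in>- T. (M *v z) $ i) \<le> (\<Sum>i\<in>- S. z $ i) + (\<Sum>i\<in>- T. \<Sum>j\<in>S. M $ i $ j)"
proof -
  note nn = doubly_stochasticD(1)[OF M]
  have "(\<Sum>i\<in>- T. (M *v z) $ i)
      = (\<Sum>i\<in>- T. \<Sum>j\<in>S. M $ i $ j * z $ j) + (\<Sum>i\<in>- T. \<Sum>j\<in>- S. M $ i $ j * z $ j)"
    by (simp add: matrix_vector_mult_def sum.distrib[symmetric] sum_Compl)
  also have "(\<Sum>i\<in>- T. \<Sum>j\<in>S. M $ i $ j * z $ j) \<le> (\<Sum>i\<in>- T. \<Sum>j\<in>S. M $ i $ j)"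
    by (intro sum_mono mult_left_le z nn)
  also have "(\<Sum>i\<in>- T. \<Sum>j\<in>- S. M $ i $ j * z $ j) \<le> (\<Sum>i\<in>UNIV. \<Sum>j\<in>- S. M $ i $ j * z $ j)"
    by (intro sum_mono2 sum_nonneg) (auto simp: nn z)
  also have "\<dots> = (\<Sum>j\<in>- S. z $ j)"
    by (subst sum.swap) (simp add: sum_distrib_right[symmetric] doubly_stochasticD[OF M])
  finally show ?thesis by linarith
qed

text \<open>
The rows of the limit agree, so all coordinates converge to a common value, which must be the mean
because the sum of the coordinates is preserved.
\<close>
lemma ergodic_consensus:
  fixes z0 :: "real ^ 'm"
  assumes A: "\<And>k. doubly_stochastic (A k)" and "ergodic_chain A"
  shows "(\<lambda>k. (chain_prod A k s *v z0) $ i) \<longlonglongrightarrow> mean z0"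
proof -
  obtain v where v: "(\<lambda>k. chain_prod A k s) \<longlonglongrightarrow> (\<chi> i j. v $ j)"
    using assms unfolding ergodic_chain_def by blast
  define c where "c = (\<Sum>j\<in>UNIV. v $ j * z0 $ j)"
  have lim: "(\<lambda>k. (chain_prod A k s *v z0) $ i) \<longlonglongrightarrow> c" for i
  proof -
    have "(\<lambda>k. \<Sum>j\<in>UNIV. chain_prod A k s $ i $ j * z0 $ j)
        \<longlonglongrightarrow> (\<Sum>j\<in>UNIV. (\<chi> i j. v $ j) $ i $ j * z0 $ j)"
      by (intro tendsto_intros v)
    then show ?thesis by (simp add: matrix_vector_mult_def c_def)
  qed
  have "(\<Sum>i\<in>UNIV. (chain_prod A k s *v z0) $ i) = (\<Sum>i\<in>UNIV. z0 $ i)" for k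
    by (induction k) (simp_all add: matrix_vector_mul_assoc[symmetric] sum_matrix_vector_mult[OF A])
  moreover have "(\<lambda>k. \<Sum>i\<in>UNIV. (chain_prod A k s *v z0) $ i) \<longlonglongrightarrow> (\<Sum>i\<in>(UNIV :: 'm set). c)"
    by (intro tendsto_sum lim)
  ultimately have "(\<Sum>i\<in>UNIV. z0 $ i) = real CARD('m) * c"
    by (simp add: LIMSEQ_const_iff)
  then have "mean z0 = c" by (simp add: mean_def)
  then show ?thesis using lim by simp
qed

text \<open>
The sets \<open>T k\<close> may move arbitrarily as long as their size is constant. Starting from the indicator of
\<open>T s\<close>, half of the accumulated flow bounds the mass that has left, but all coordinates tend to
\<open>n / m\<close>, so the mass outside \<open>T k\<close> tends to \<open>(m - n) * n / m\<close>.
\<close>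
lemma ergodic_flow_accumulates:
  fixes T :: "nat \<Rightarrow> 'm::finite set"
  assumes A: "\<And>k. doubly_stochastic (A k)" and erg: "ergodic_chain A" and \<delta>: "\<delta> < 1"
    and card: "\<And>k. card (T k) = n" and n: "0 < n" "n < CARD('m)"
  shows "\<exists>t\<ge>s. \<delta> \<le> (\<Sum>k\<in>{s..<t}. cross_flow (A k) (T (Suc k)) (T k))"
proof -
  define z0 :: "real ^ 'm" where "z0 = (\<chi> i. if i \<in> T s then 1 else 0)"
  define z where "z k = chain_prod A k s *v z0" for k
  define c where "c = real n / real CARD('m)"
  have zs: "z s = z0" by (cases s) (simp_all add: z_def)
  have step: "z (Suc k) = A k *v z k" if "s \<le> k" for k
    using that by (simp add: z_def matrix_vector_mul_assoc)
  have bounds: "\<forall>i. 0 \<le> z k $ i \<and> z k $ i \<le> 1" if "s \<le> k" for k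
    using that
  proof (induction k rule: dec_induct)
    case base
    then show ?case by (simp add: zs z0_def)
  next
    case (step k)
    have "(\<Sum>j\<in>UNIV. A k $ i $ j * z k $ j) \<le> (\<Sum>j\<in>UNIV. A k $ i $ j)" for i
      using step by (intro sum_mono mult_left_le) (auto simp: doubly_stochasticD[OF A])
    then show ?case
      using step \<open>s \<le> k \<Longrightarrow> z (Suc k) = A k *v z k\<close>
      by (auto simp: matrix_vector_mult_def doubly_stochasticD[OF A] intro!: sum_nonneg)
  qed
  have outside: "2 * (\<Sum>i\<in>- T t. z t $ i) \<le> (\<Sum>k\<in>{s..<t}. cross_flow (A k) (T (Suc k)) (T k))"
    if "s \<le> t" for t
    using that
  proof (induction t rule: dec_induct)
    case base
    then show ?case by (simp add: zs z0_def)
  next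
    case (step k)
    have "(\<Sum>i\<in>- T (Suc k). (A k *v z k) $ i)
        \<le> (\<Sum>i\<in>- T k. z k $ i) + (\<Sum>i\<in>- T (Suc k). \<Sum>j\<in>T k. A k $ i $ j)"
      using bounds[OF step(1)] by (intro outside_mass_step A) auto
    moreover have "cross_flow (A k) (T (Suc k)) (T k) = 2 * (\<Sum>i\<in>- T (Suc k). \<Sum>j\<in>T k. A k $ i $ j)"
      by (rule cross_flow_eq_twice_outflow[OF A]) (simp add: card)
    ultimately show ?case
      using step \<open>s \<le> k \<Longrightarrow> z (Suc k) = A k *v z k\<close> by simp
  qed
  have mean: "mean z0 = c"
    by (simp add: mean_def z0_def c_def sum.If_cases card)
  have c: "0 < c" using n by (simp add: c_def)
  have "\<forall>\<^sub>F k in sequentially. \<forall>i. \<delta> * c < z k $ i"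
  proof -
    have "\<delta> * c < mean z0" using \<delta> c by (simp add: mean)
    then have "\<forall>\<^sub>F k in sequentially. \<delta> * c < z k $ i" for i
      unfolding z_def by (intro order_tendstoD(1)[OF ergodic_consensus[OF A erg]])
    then show ?thesis by (simp add: eventually_all_finite)
  qed
  then obtain t where t: "t \<ge> s" "\<And>i. \<delta> * c < z t $ i"
    unfolding eventually_sequentially by (meson le_cases order_refl)
  \<comment> \<open>\<open>(n - 1) (m - n - 1) \<ge> 0\<close> means \<open>n (m - n) \<ge> m - 1\<close>, and \<open>2 (m - 1) \<ge> m\<close>.\<close>
  have half: "1 \<le> 2 * (real (CARD('m) - n) * c)"
  proof -
    have "0 \<le> (real n - 1) * (real CARD('m) - real n - 1)"
      using n by (intro mult_nonneg_nonneg) auto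
    then have "real CARD('m) \<le> 2 * ((real CARD('m) - real n) * real n)"
      using n by (simp add: algebra_simps)
    then show ?thesis using n by (simp add: c_def field_simps)
  qed
  have "real (CARD('m) - n) * (\<delta> * c) \<le> (\<Sum>i\<in>- T t. z t $ i)"
    using sum_bounded_below[of "- T t" "\<delta> * c" "\<lambda>i. z t $ i"] t
    by (simp add: Compl_eq_Diff_UNIV card_Diff_subset card less_imp_le)
  show ?thesis
  proof (cases "0 \<le> \<delta>")
    case True
    have "\<delta> \<le> \<delta> * (2 * (real (CARD('m) - n) * c))"
      using half True mult_left_mono[OF half True] by simp
    also have "\<dots> \<le> 2 * (\<Sum>i\<in>- T t. z t $ i)"
      using \<open>real (CARD('m) - n) * (\<delta> * c) \<le> _\<close> by (simp add: algebra_simps)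
    also note outside[OF t(1)]
    finally show ?thesis using t(1) by blast
  next
    case False
    then show ?thesis by (intro exI[of _ s]) auto
  qed
qed

lemma accumulated_flow_mono:
  assumes "\<And>k. doubly_stochastic (A k)" and "t \<le> t'"
  shows "accumulated_flow A P s t S \<le> accumulated_flow A P s t' S"
  unfolding accumulated_flow_def using assms
  by (intro sum_mono2) (auto intro: cross_flow_nonneg)

lemma min_accumulated_flow_ge_iff:
  fixes A :: "'m::finite chain"
  assumes "2 \<le> CARD('m)"
  shows "\<delta> \<le> min_accumulated_flow A P s t
    \<longleftrightarrow> (\<forall>S. S \<noteq> {} \<and> S \<noteq> UNIV \<longrightarrow> \<delta> \<le> accumulated_flow A P s t S)"
proof -
  have "{undefined} \<noteq> (UNIV :: 'm set)"
    using assms by (metis One_nat_def card.empty card.insert empty_iff finite.emptyI not_less_eq_eq numeral_2_eq_2 order_refl)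
  then have "{S :: 'm set. S \<noteq> {} \<and> S \<noteq> UNIV} \<noteq> {}" by blast
  then show ?thesis
    unfolding min_accumulated_flow_def by (subst Min_ge_iff) auto
qed

text \<open>
There are finitely many sets and the accumulated flow is monotone in the final time, so the
largest of the individual times works for all of them.
\<close>
lemma exists_accumulation_time:
  fixes A :: "'m::finite chain"
  assumes m: "2 \<le> CARD('m)" and A: "\<And>k. doubly_stochastic (A k)" and erg: "ergodic_chain A"
    and P: "\<And>k. permutation_matrix (P k)" and \<delta>: "\<delta> < 1"
  shows "\<exists>t. s + 1 \<le> t \<and> \<delta> \<le> min_accumulated_flow A P s t"
proof -
  obtain \<pi> :: "nat \<Rightarrow> 'm \<Rightarrow> 'm" where \<pi>: "\<And>k. bij (\<pi> k)"
    and traj: "\<And>k S. trajectory P S k = \<pi> k ` S"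
    by (rule chain_prod_permutation[OF P]) (rule that)
  have "\<exists>t. \<delta> \<le> accumulated_flow A P s t S" if "S \<noteq> {}" "S \<noteq> UNIV" for S
  proof -
    have "card (\<pi> k ` S) = card S" for k
      using \<pi> by (metis bij_is_inj card_image inj_on_subset subset_UNIV)
    moreover have "0 < card S" using that by (simp add: card_gt_0_iff)
    moreover have "card S < CARD('m)" using that by (simp add: psubset_card_mono psubset_eq)
    ultimately show ?thesis
      using ergodic_flow_accumulates[OF A erg \<delta>, of "\<lambda>k. \<pi> k ` S" "card S" s]
      by (auto simp: accumulated_flow_def traj)
  qed
  then obtain \<tau> where \<tau>: "\<And>S. S \<noteq> {} \<Longrightarrow> S \<noteq> UNIV \<Longrightarrow> \<delta> \<le> accumulated_flow A P s (\<tau> S) S"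
    by metis
  define t where "t = Max (insert (s + 1) (range \<tau>))"
  have le: "\<tau> S \<le> t" for S unfolding t_def by (intro Max_ge) auto
  have "\<delta> \<le> accumulated_flow A P s t S" if "S \<noteq> {}" "S \<noteq> UNIV" for S
    by (rule order_trans[OF \<tau>[OF that] accumulated_flow_mono[OF A le]])
  moreover have "s + 1 \<le> t" unfolding t_def by (intro Max_ge) auto
  ultimately show ?thesis
    unfolding min_accumulated_flow_ge_iff[OF m] by (intro exI[of _ t]) simp
qed

section \<open>Contraction between accumulation times\<close>

theorem theorem6:
  fixes A P :: "nat \<Rightarrow> real ^ 'm ^ 'm"
    and x :: "nat \<Rightarrow> real ^ 'm"
    and \<gamma> \<delta> :: real
    and t :: "nat \<Rightarrow> nat"
  assumes "CARD('m) \<ge> 2"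
    and "\<And>k. doubly_stochastic (A k)"
    and "ergodic_chain A"
    and "permutation_component A P \<gamma>"
    and "0 < \<delta>" and "\<delta> < 1"
    and "\<And>q. t q = accumulation_time A P \<delta> q"
    and "\<And>k. x (Suc k) = A k *v x k"
  shows "\<forall>q\<ge>1. V (x (t q))
           \<le> (1 - \<gamma> * \<delta> * (1 - \<delta>)\<^sup>2 / (real CARD('m) * (real CARD('m) - 1)\<^sup>2))
               * V (x (t (q - 1)))"
proof (intro allI impI)
  fix q :: nat
  assume "1 \<le> q"
  then obtain r where q: "q = Suc r" by (cases q) auto
  have perm: "\<And>k. permutation_matrix (P k)"
    using assms(4) by (simp add: permutation_component_def)
  have "t r + 1 \<le> t q \<and> \<delta> \<le> min_accumulated_flow A P (t r) (t q)"
    unfolding q assms(7) accumulation_time.simps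
    by (rule LeastI_ex) (rule exists_accumulation_time[OF assms(1,2,3) perm assms(6)])
  then have "t r \<le> t q"
    and "\<And>S. S \<noteq> {} \<Longrightarrow> S \<noteq> UNIV \<Longrightarrow> \<delta> \<le> accumulated_flow A P (t r) (t q) S"
    using min_accumulated_flow_ge_iff[OF assms(1)] by auto
  then have "V (x (t q)) \<le> (1 - \<gamma> * \<delta> * (1 - \<delta>)\<^sup>2 / (real CARD('m) * (real CARD('m) - 1)\<^sup>2)) * V (x (t r))"
    by (intro V_contraction[OF assms(1,2,4,5,6,8)]) auto
  then show "V (x (t q)) \<le> (1 - \<gamma> * \<delta> * (1 - \<delta>)\<^sup>2 / (real CARD('m) * (real CARD('m) - 1)\<^sup>2))
      * V (x (t (q - 1)))"
    by (simp add: q)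
qed

end
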